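(* Let $M$ be a residually finite monoid and let $A$ be a finite set. Let $\mathrm{CA}(M,A)$ denote the monoid, under composition of maps, of all cellular automata $\tau \colon A^M \to A^M$ over the monoid $M$ and the alphabet $A$. Suppose that $T$ is a finitely generated subsemigroup of $\mathrm{CA}(M,A)$. Then the monoid $\mathrm{End}(T)$ of endomorphisms of $T$ is residually finite.
   Context: A semigroup is a set with an associative binary operation; a semigroup morphism is a map preserving products. For a semigroup $T$, $\mathrm{End}(T)$ is the monoid, under composition of maps, of all semigroup morphisms $T \to T$. Finitely generated subsemigroup means finitely generated as a semigroup. A monoid is a semigroup admitting an identity element; a monoid morphism is a semigroup morphism sending the identity element to the identity element. A monoid $N$ is residually finite if for any two distinct elements $n_1, n_2 \in N$ there exist a finite monoid $F$ and a monoid morphism $\rho \colon N \to F$ such that $\rho(n_1) \neq \rho(n_2)$. For a monoid $M$ and a finite set $A$ (the alphabet), $A^M$ denotes the set of all maps $x \colon M \to A$ (configurations). It is equipped with the prodiscrete topology, i.e. the product topology on $A^M = \prod_{m \in M} A$ where each factor $A$ carries the discrete topology, and with the $M$-shift, i.e. the action of $M$ given by $(m,x) \mapsto mx$, where $(mx)(m') = x(m'm)$ for all $x \in A^M$ and $m, m' \in M$. A cellular automaton over $M$ and $A$ is a map $\tau \colon A^M \to A^M$ that is continuous for the prodiscrete topology and satisfies $\tau(mx) = m\tau(x)$ for all $m \in M$ and $x \in A^M$. *)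

theory Defs
  imports "HOL-Analysis.Function_Topology" "HOL-Algebra.Group"
begin

text \<open>
  A semigroup is represented by a \<^type>\<open>monoid\<close> record whose \<^const>\<open>one\<close> field is ignored, and a
  subsemigroup by its carrier set. The empty subsemigroup is allowed.
\<close>

definition subsemigroup :: "'a set \<Rightarrow> ('a, 'b) monoid_scheme \<Rightarrow> bool" where
  "subsemigroup T G \<longleftrightarrow>
     T \<subseteq> carrier G \<and> (\<forall>x\<in>T. \<forall>y\<in>T. x \<otimes>\<^bsub>G\<^esub> y \<in> T)"

inductive_set semigroup_generate :: "('a, 'b) monoid_scheme \<Rightarrow> 'a set \<Rightarrow> 'a set"
  for G and S where
  incl: "x \<in> S \<Longrightarrow> x \<in> semigroup_generate G S"
| mult: "x \<in> semigroup_generate G S \<Longrightarrow> y \<in> semigroup_generate G S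
           \<Longrightarrow> x \<otimes>\<^bsub>G\<^esub> y \<in> semigroup_generate G S"

definition finitely_generated_semigroup :: "('a, 'b) monoid_scheme \<Rightarrow> bool" where
  "finitely_generated_semigroup G \<longleftrightarrow>
     (\<exists>S. finite S \<and> S \<subseteq> carrier G \<and> carrier G = semigroup_generate G S)"

text \<open>
  Endomorphisms are extensional functions, so that equality in HOL is equality
  of maps on the carrier. \<^const>\<open>hom\<close> only refers to carrier and multiplication, so these are the
  semigroup morphisms, with no condition on a possible identity element.
\<close>

definition End :: "('a, 'b) monoid_scheme \<Rightarrow> ('a \<Rightarrow> 'a) monoid" where
  "End G = \<lparr>carrier = hom G G \<inter> extensional (carrier G),
            mult = compose (carrier G),
            one = (\<lambda>x\<in>carrier G. x)\<rparr>"

definition monoid_hom :: "('a, 'c) monoid_scheme \<Rightarrow> ('b, 'd) monoid_scheme \<Rightarrow> ('a \<Rightarrow> 'b) set" where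
  "monoid_hom G H = {h \<in> hom G H. h \<one>\<^bsub>G\<^esub> = \<one>\<^bsub>H\<^esub>}"

text \<open>
  HOL cannot quantify over types inside a definition, so the finite monoids range over those
  carried by a set of natural numbers. Every finite monoid is isomorphic to one of these; see
  \<open>finite_monoid_separation_nat\<close> below.
\<close>

locale residually_finite_monoid = monoid N for N (structure) +
  assumes separated: "\<lbrakk>x \<in> carrier N; y \<in> carrier N; x \<noteq> y\<rbrakk> \<Longrightarrow>
    \<exists>(F :: nat monoid) \<rho>. monoid F \<and> finite (carrier F) \<and> \<rho> \<in> monoid_hom N F \<and> \<rho> x \<noteq> \<rho> y"

lemma finite_monoid_separation_nat:
  fixes F :: "('b, 'd) monoid_scheme"
  assumes F: "monoid F" "finite (carrier F)"
    and h: "h \<in> monoid_hom N F" and xy: "x \<in> carrier N" "y \<in> carrier N" "h x \<noteq> h y"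
  shows "\<exists>(F' :: nat monoid) \<rho>. monoid F' \<and> finite (carrier F') \<and> \<rho> \<in> monoid_hom N F' \<and> \<rho> x \<noteq> \<rho> y"
proof -
  interpret F: monoid F by (fact F)
  obtain e :: "'b \<Rightarrow> nat" where e: "inj_on e (carrier F)"
    using finite_imp_inj_to_nat_seg[OF F(2)] by blast
  define d where "d = inv_into (carrier F) e"
  have d: "d (e a) = a" if "a \<in> carrier F" for a
    using e that by (simp add: d_def)
  define F' where "F' = \<lparr>carrier = e ` carrier F, mult = (\<lambda>a b. e (d a \<otimes>\<^bsub>F\<^esub> d b)), one = e \<one>\<^bsub>F\<^esub>\<rparr>"
  have "monoid F'"
    by (rule monoidI) (auto simp: F'_def d F.m_assoc)
  moreover have "finite (carrier F')"
    using F(2) by (simp add: F'_def)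
  moreover have "e \<circ> h \<in> monoid_hom N F'"
    using h by (auto simp: monoid_hom_def hom_def F'_def d Pi_iff)
  moreover have "(e \<circ> h) x \<noteq> (e \<circ> h) y"
    using h xy inj_on_eq_iff[OF e] by (simp add: monoid_hom_def hom_def Pi_iff)
  ultimately show ?thesis by blast
qed

definition configurations :: "('m, 'z) monoid_scheme \<Rightarrow> 'a set \<Rightarrow> ('m \<Rightarrow> 'a) set" where
  "configurations M A = carrier M \<rightarrow>\<^sub>E A"

definition prodiscrete_topology :: "('m, 'z) monoid_scheme \<Rightarrow> 'a set \<Rightarrow> ('m \<Rightarrow> 'a) topology" where
  "prodiscrete_topology M A = product_topology (\<lambda>_. discrete_topology A) (carrier M)"

definition shift :: "('m, 'z) monoid_scheme \<Rightarrow> 'm \<Rightarrow> ('m \<Rightarrow> 'a) \<Rightarrow> ('m \<Rightarrow> 'a)" where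
  "shift M m x = (\<lambda>m'\<in>carrier M. x (m' \<otimes>\<^bsub>M\<^esub> m))"

definition cellular_automaton ::
    "('m, 'z) monoid_scheme \<Rightarrow> 'a set \<Rightarrow> (('m \<Rightarrow> 'a) \<Rightarrow> ('m \<Rightarrow> 'a)) \<Rightarrow> bool" where
  "cellular_automaton M A \<tau> \<longleftrightarrow>
     \<tau> \<in> configurations M A \<rightarrow>\<^sub>E configurations M A \<and>
     continuous_map (prodiscrete_topology M A) (prodiscrete_topology M A) \<tau> \<and>
     (\<forall>m\<in>carrier M. \<forall>x\<in>configurations M A. \<tau> (shift M m x) = shift M m (\<tau> x))"

definition CA :: "('m, 'z) monoid_scheme \<Rightarrow> 'a set \<Rightarrow> (('m \<Rightarrow> 'a) \<Rightarrow> ('m \<Rightarrow> 'a)) monoid" where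
  "CA M A = \<lparr>carrier = {\<tau>. cellular_automaton M A \<tau>},
             mult = compose (configurations M A),
             one = (\<lambda>x\<in>configurations M A. x)\<rparr>"

lemma topspace_prodiscrete [simp]:
  "topspace (prodiscrete_topology M A) = configurations M A"
  by (simp add: prodiscrete_topology_def configurations_def)

lemma shift_configurations:
  assumes "monoid M" "m \<in> carrier M" "x \<in> configurations M A"
  shows "shift M m x \<in> configurations M A"
  using assms by (simp add: shift_def configurations_def monoid.m_closed PiE_iff)

lemma monoid_CA:
  assumes "monoid M"
  shows "monoid (CA M A)"
proof (rule monoidI)
  fix \<sigma> \<tau> assume *: "\<sigma> \<in> carrier (CA M A)" "\<tau> \<in> carrier (CA M A)"
  then have "continuous_map (prodiscrete_topology M A) (prodiscrete_topology M A) (\<sigma> \<circ> \<tau>)"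
    by (auto simp: CA_def cellular_automaton_def intro: continuous_map_compose)
  then have "continuous_map (prodiscrete_topology M A) (prodiscrete_topology M A)
      (compose (configurations M A) \<sigma> \<tau>)"
    by (rule continuous_map_eq) (simp add: compose_def)
  with * show "\<sigma> \<otimes>\<^bsub>CA M A\<^esub> \<tau> \<in> carrier (CA M A)"
    using shift_configurations[OF assms]
    by (auto simp add: CA_def cellular_automaton_def compose_def PiE_iff)
next
  have "continuous_map (prodiscrete_topology M A) (prodiscrete_topology M A)
      (\<lambda>x\<in>configurations M A. x)"
    by (rule continuous_map_eq[OF continuous_map_id]) simp
  then show "\<one>\<^bsub>CA M A\<^esub> \<in> carrier (CA M A)"
    using shift_configurations[OF assms] by (auto simp: CA_def cellular_automaton_def)
next
  fix \<rho> \<sigma> \<tau> assume "\<rho> \<in> carrier (CA M A)" "\<sigma> \<in> carrier (CA M A)" "\<tau> \<in> carrier (CA M A)"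
  then show "\<rho> \<otimes>\<^bsub>CA M A\<^esub> \<sigma> \<otimes>\<^bsub>CA M A\<^esub> \<tau> = \<rho> \<otimes>\<^bsub>CA M A\<^esub> (\<sigma> \<otimes>\<^bsub>CA M A\<^esub> \<tau>)"
    by (simp add: CA_def cellular_automaton_def compose_def fun_eq_iff PiE_iff)
next
  fix \<tau> assume "\<tau> \<in> carrier (CA M A)"
  then have \<tau>: "\<tau> \<in> configurations M A \<rightarrow>\<^sub>E configurations M A"
    by (simp add: CA_def cellular_automaton_def)
  show "\<one>\<^bsub>CA M A\<^esub> \<otimes>\<^bsub>CA M A\<^esub> \<tau> = \<tau>" "\<tau> \<otimes>\<^bsub>CA M A\<^esub> \<one>\<^bsub>CA M A\<^esub> = \<tau>"
    using \<tau> by (auto simp: CA_def PiE_def intro!: Id_compose compose_Id)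
qed

lemma monoid_End:
  assumes "\<And>x y. x \<in> carrier G \<Longrightarrow> y \<in> carrier G \<Longrightarrow> x \<otimes>\<^bsub>G\<^esub> y \<in> carrier G"
  shows "monoid (End G)"
proof (rule monoidI)
  fix f g assume "f \<in> carrier (End G)" "g \<in> carrier (End G)"
  then show "f \<otimes>\<^bsub>End G\<^esub> g \<in> carrier (End G)"
    by (simp add: End_def hom_def compose_def Pi_iff assms)
next
  show "\<one>\<^bsub>End G\<^esub> \<in> carrier (End G)"
    by (simp add: End_def hom_def assms)
next
  fix f g h assume "f \<in> carrier (End G)" "g \<in> carrier (End G)" "h \<in> carrier (End G)"
  then show "f \<otimes>\<^bsub>End G\<^esub> g \<otimes>\<^bsub>End G\<^esub> h = f \<otimes>\<^bsub>End G\<^esub> (g \<otimes>\<^bsub>End G\<^esub> h)"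
    by (simp add: End_def hom_def compose_def fun_eq_iff Pi_iff)
next
  fix f assume "f \<in> carrier (End G)"
  then have f: "f \<in> carrier G \<rightarrow> carrier G" "f \<in> extensional (carrier G)"
    by (simp_all add: End_def hom_def)
  then show "\<one>\<^bsub>End G\<^esub> \<otimes>\<^bsub>End G\<^esub> f = f" "f \<otimes>\<^bsub>End G\<^esub> \<one>\<^bsub>End G\<^esub> = f"
    by (auto simp: End_def intro!: Id_compose compose_Id)
qed

end

theory Submission
  imports Defs
begin

text \<open>
  Both halves of the proof separate two elements of a monoid by letting the monoid act on a
  finite set, so that the finite quotient is a monoid of self-maps of that set.

  Cellular automata act on periodic configurations. Suppose that \<open>\<sigma>\<close> and \<open>\<tau>\<close> disagree
  on some configuration; by equivariance they disagree at the identity of \<open>M\<close> on some \<open>x\<close>, and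
  by continuity they still do so on every configuration that agrees with \<open>x\<close> on a certain finite
  set \<open>S\<close> (\<open>cellular_automaton_local\<close>). Residual finiteness of \<open>M\<close> gives a map \<open>\<kappa>\<close> with finite
  range that is injective on \<open>S\<close> and whose fibres are respected by left multiplication
  (\<open>finite_index_separation\<close>). The configurations constant on the fibres of \<open>\<kappa>\<close> form a finite set
  that every cellular automaton preserves (\<open>cellular_automaton_periodic\<close>), and injectivity of
  \<open>\<kappa>\<close> on \<open>S\<close> provides one that agrees with \<open>x\<close> on \<open>S\<close>. Hence \<open>CA(M,A)\<close> is residually finite, and
  any two elements of a subsemigroup \<open>T\<close> are separated by a morphism to a finite semigroup.

  Endomorphisms act on morphisms by precomposition. If \<open>f t \<noteq> g t\<close> and \<open>\<phi> : T \<rightarrow> F\<close>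
  separates \<open>f t\<close> from \<open>g t\<close>, with \<open>F\<close> finite, then \<open>\<phi> \<circ> f \<noteq> \<phi> \<circ> g\<close>. Since \<open>T\<close> is finitely
  generated, there are only finitely many morphisms \<open>T \<rightarrow> F\<close>, and \<open>End(T)\<close> acts on this finite set
  from the right, which separates \<open>f\<close> from \<open>g\<close> (\<open>residually_finite_End\<close>).
\<close>

section \<open>Transformation monoids\<close>

definition transformation_monoid :: "'a set \<Rightarrow> ('a \<Rightarrow> 'a) monoid" where
  "transformation_monoid X =
     \<lparr>carrier = X \<rightarrow>\<^sub>E X, mult = compose X, one = (\<lambda>x\<in>X. x)\<rparr>"

definition opposite_monoid :: "('a, 'b) monoid_scheme \<Rightarrow> 'a monoid" where
  "opposite_monoid G =
     \<lparr>carrier = carrier G, mult = (\<lambda>x y. y \<otimes>\<^bsub>G\<^esub> x), one = \<one>\<^bsub>G\<^esub>\<rparr>"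

lemma monoid_transformation_monoid: "monoid (transformation_monoid X)"
  by (rule monoidI)
    (auto simp: transformation_monoid_def compose_def fun_eq_iff PiE_iff extensional_def)

lemma monoid_opposite_monoid:
  assumes "monoid G"
  shows "monoid (opposite_monoid G)"
proof -
  interpret G: monoid G by (fact assms)
  show ?thesis
    by (rule monoidI) (simp_all add: opposite_monoid_def G.m_assoc)
qed

lemma finite_transformation_monoid:
  assumes "finite X"
  shows "finite (carrier (transformation_monoid X))"
  using assms by (simp add: transformation_monoid_def finite_PiE)

section \<open>Cellular automata on periodic configurations\<close>

text \<open>
  Continuity of \<open>\<tau>\<close> at the single configuration \<open>x\<close>, spelled out with basic open sets. The window
  \<open>S\<close> depends on \<open>x\<close>, which suffices to separate two automata that differ at \<open>x\<close>.
\<close>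

lemma cellular_automaton_local:
  assumes \<tau>: "cellular_automaton M A \<tau>"
    and x: "x \<in> configurations M A" and m: "m \<in> carrier M"
  obtains S where "finite S" "S \<subseteq> carrier M"
    "\<And>y. y \<in> configurations M A \<Longrightarrow> (\<And>s. s \<in> S \<Longrightarrow> y s = x s) \<Longrightarrow> \<tau> y m = \<tau> x m"
proof -
  let ?X = "prodiscrete_topology M A"
  have "continuous_map ?X ?X \<tau>"
    using \<tau> by (simp add: cellular_automaton_def)
  moreover have "continuous_map ?X (discrete_topology A) (\<lambda>z. z m)"
    unfolding prodiscrete_topology_def by (rule continuous_map_product_projection[OF m])
  ultimately have c: "continuous_map ?X (discrete_topology A) (\<lambda>z. \<tau> z m)"
    by (rule continuous_map_compose[unfolded comp_def])
  have "\<tau> x m \<in> A"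
    using \<tau> x m by (auto simp: cellular_automaton_def configurations_def)
  then have "openin ?X {z \<in> configurations M A. \<tau> z m \<in> {\<tau> x m}}" (is "openin _ ?V")
    using openin_continuous_map_preimage[OF c, of "{\<tau> x m}"] by simp
  moreover have "x \<in> ?V"
    using x by simp
  ultimately obtain U where U: "finite {i \<in> carrier M. U i \<noteq> A}" "x \<in> Pi\<^sub>E (carrier M) U"
      "Pi\<^sub>E (carrier M) U \<subseteq> ?V"
    unfolding prodiscrete_topology_def openin_product_topology_alt topspace_discrete_topology
    by (meson bspec)
  show thesis
  proof (rule that[OF U(1)])
    fix y assume y: "y \<in> configurations M A"
      and eq: "\<And>s. s \<in> {i \<in> carrier M. U i \<noteq> A} \<Longrightarrow> y s = x s"
    have "y i \<in> U i" if "i \<in> carrier M" for i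
      using that y eq[of i] U(2) by (cases "U i = A") (auto simp: configurations_def PiE_iff)
    then have "y \<in> Pi\<^sub>E (carrier M) U"
      using y by (auto simp: configurations_def PiE_iff)
    then show "\<tau> y m = \<tau> x m"
      using U(3) by auto
  qed auto
qed

text \<open>
  The map \<open>\<kappa>\<close> lists the values of one separating morphism for each pair of distinct elements of
  \<open>S\<close>. Only its fibres matter below, so its range is given no multiplication: left
  compatibility is what remains of the product of those finitely many morphisms.
\<close>

lemma finite_index_separation:
  fixes M :: "('m, 'z) monoid_scheme" (structure)
  assumes "residually_finite_monoid M" and S: "finite S" "S \<subseteq> carrier M"
  obtains \<kappa> :: "'m \<Rightarrow> 'm \<times> 'm \<Rightarrow> nat" where "finite (\<kappa> ` carrier M)" "inj_on \<kappa> S"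
    "\<And>n m m'. n \<in> carrier M \<Longrightarrow> m \<in> carrier M \<Longrightarrow> m' \<in> carrier M \<Longrightarrow> \<kappa> m = \<kappa> m' \<Longrightarrow>
       \<kappa> (n \<otimes>\<^bsub>M\<^esub> m) = \<kappa> (n \<otimes>\<^bsub>M\<^esub> m')"
proof -
  interpret residually_finite_monoid M by fact
  define P where "P = {(s, t). s \<in> S \<and> t \<in> S \<and> s \<noteq> t}"
  have P: "finite P"
    by (rule finite_subset[of _ "S \<times> S"]) (auto simp: P_def S)
  have "\<forall>p\<in>P. \<exists>\<rho>. \<exists>F :: nat monoid.
      finite (carrier F) \<and> \<rho> \<in> hom M F \<and> \<rho> (fst p) \<noteq> \<rho> (snd p)"
  proof
    fix p assume "p \<in> P"
    then have "fst p \<in> carrier M" "snd p \<in> carrier M" "fst p \<noteq> snd p"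
      using S(2) by (auto simp: P_def)
    from separated[OF this] show "\<exists>\<rho>. \<exists>F :: nat monoid.
        finite (carrier F) \<and> \<rho> \<in> hom M F \<and> \<rho> (fst p) \<noteq> \<rho> (snd p)"
      unfolding monoid_hom_def by blast
  qed
  from bchoice[OF this] obtain \<rho> where "\<forall>p\<in>P. \<exists>F :: nat monoid.
      finite (carrier F) \<and> \<rho> p \<in> hom M F \<and> \<rho> p (fst p) \<noteq> \<rho> p (snd p)" ..
  from bchoice[OF this] obtain F :: "_ \<Rightarrow> nat monoid" where
    "\<forall>p\<in>P. finite (carrier (F p)) \<and> \<rho> p \<in> hom M (F p) \<and> \<rho> p (fst p) \<noteq> \<rho> p (snd p)" ..
  then have F: "\<And>p. p \<in> P \<Longrightarrow> finite (carrier (F p))"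
    and \<rho>: "\<And>p. p \<in> P \<Longrightarrow> \<rho> p \<in> hom M (F p)"
    and sep: "\<And>p. p \<in> P \<Longrightarrow> \<rho> p (fst p) \<noteq> \<rho> p (snd p)"
    by auto
  define \<kappa> where "\<kappa> m = (\<lambda>p\<in>P. \<rho> p m)" for m
  have \<kappa>_iff: "\<kappa> m = \<kappa> m' \<longleftrightarrow> (\<forall>p\<in>P. \<rho> p m = \<rho> p m')" for m m'
    by (auto simp: \<kappa>_def fun_eq_iff restrict_def)
  show thesis
  proof (rule that)
    show "finite (\<kappa> ` carrier M)"
    proof (rule finite_subset)
      show "\<kappa> ` carrier M \<subseteq> (\<Pi>\<^sub>E p\<in>P. carrier (F p))"
        using hom_in_carrier[OF \<rho>] by (auto simp: \<kappa>_def)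
      show "finite (\<Pi>\<^sub>E p\<in>P. carrier (F p))"
        using P F by (simp add: finite_PiE)
    qed
    show "inj_on \<kappa> S"
    proof (rule inj_onI, rule ccontr)
      fix s t assume "s \<in> S" "t \<in> S" "\<kappa> s = \<kappa> t" "s \<noteq> t"
      then show False
        using sep[of "(s, t)"] by (auto simp: \<kappa>_iff P_def)
    qed
    show "\<kappa> (n \<otimes> m) = \<kappa> (n \<otimes> m')"
      if "n \<in> carrier M" "m \<in> carrier M" "m' \<in> carrier M" "\<kappa> m = \<kappa> m'" for n m m'
      using that by (simp add: \<kappa>_iff hom_mult[OF \<rho>])
  qed
qed

text \<open>
  When \<open>\<kappa>\<close> is a morphism from \<open>M\<close> onto a monoid \<open>F\<close>, these are the configurations \<open>z \<circ> \<kappa>\<close> with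
  \<open>z : F \<rightarrow> A\<close>.
\<close>

definition periodic_configurations ::
    "('m, 'z) monoid_scheme \<Rightarrow> 'a set \<Rightarrow> ('m \<Rightarrow> 'k) \<Rightarrow> ('m \<Rightarrow> 'a) set" where
  "periodic_configurations M A \<kappa> =
     {y \<in> configurations M A. \<forall>m\<in>carrier M. \<forall>m'\<in>carrier M. \<kappa> m = \<kappa> m' \<longrightarrow> y m = y m'}"

lemma periodic_configurationsD:
  assumes "y \<in> periodic_configurations M A \<kappa>"
  shows "y \<in> configurations M A"
    and "m \<in> carrier M \<Longrightarrow> m' \<in> carrier M \<Longrightarrow> \<kappa> m = \<kappa> m' \<Longrightarrow> y m = y m'"
  using assms unfolding periodic_configurations_def by blast+

lemma finite_periodic_configurations:
  assumes "finite A" "finite (\<kappa> ` carrier M)"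
  shows "finite (periodic_configurations M A \<kappa>)"
proof (rule finite_subset)
  let ?K = "\<kappa> ` carrier M" and ?lift = "\<lambda>z. \<lambda>m\<in>carrier M. z (\<kappa> m)"
  show "finite (?lift ` (?K \<rightarrow>\<^sub>E A))"
    using assms by (simp add: finite_PiE)
  show "periodic_configurations M A \<kappa> \<subseteq> ?lift ` (?K \<rightarrow>\<^sub>E A)"
  proof
    fix y assume y: "y \<in> periodic_configurations M A \<kappa>"
    define z where "z = (\<lambda>k\<in>?K. y (inv_into (carrier M) \<kappa> k))"
    have rep: "inv_into (carrier M) \<kappa> (\<kappa> m) \<in> carrier M"
        "\<kappa> (inv_into (carrier M) \<kappa> (\<kappa> m)) = \<kappa> m" if "m \<in> carrier M" for m
      using that by (simp_all add: inv_into_into f_inv_into_f)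
    have "y = ?lift z"
    proof
      fix m show "y m = ?lift z m"
      proof (cases "m \<in> carrier M")
        case True
        then have "y (inv_into (carrier M) \<kappa> (\<kappa> m)) = y m"
          by (intro periodic_configurationsD(2)[OF y] rep)
        with True show ?thesis by (simp add: z_def)
      next
        case False
        with periodic_configurationsD(1)[OF y] show ?thesis
          by (auto simp: configurations_def)
      qed
    qed
    moreover have "z \<in> ?K \<rightarrow>\<^sub>E A"
      using periodic_configurationsD(1)[OF y] rep(1) by (auto simp: z_def configurations_def)
    ultimately show "y \<in> ?lift ` (?K \<rightarrow>\<^sub>E A)" by blast
  qed
qed

lemma cellular_automaton_value_at_one:
  assumes "monoid M" "cellular_automaton M A \<tau>" "x \<in> configurations M A" "m \<in> carrier M"
  shows "\<tau> x m = \<tau> (shift M m x) \<one>\<^bsub>M\<^esub>"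
proof -
  interpret monoid M by fact
  have "\<tau> (shift M m x) = shift M m (\<tau> x)"
    using assms by (simp add: cellular_automaton_def)
  then show ?thesis using assms(4) by (simp add: shift_def)
qed

text \<open>
  If \<open>\<kappa> m = \<kappa> m'\<close>, left compatibility makes the shifts of a periodic configuration by \<open>m\<close> and by
  \<open>m'\<close> equal, and the values of its image at \<open>m\<close> and \<open>m'\<close> can be read off from these shifts.
\<close>

lemma cellular_automaton_periodic:
  assumes M: "monoid M" and \<tau>: "cellular_automaton M A \<tau>"
    and \<kappa>: "\<And>n m m'. n \<in> carrier M \<Longrightarrow> m \<in> carrier M \<Longrightarrow> m' \<in> carrier M \<Longrightarrow> \<kappa> m = \<kappa> m' \<Longrightarrow>
       \<kappa> (n \<otimes>\<^bsub>M\<^esub> m) = \<kappa> (n \<otimes>\<^bsub>M\<^esub> m')"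
    and y: "y \<in> periodic_configurations M A \<kappa>"
  shows "\<tau> y \<in> periodic_configurations M A \<kappa>"
proof -
  interpret monoid M by fact
  have yc: "y \<in> configurations M A"
    by (rule periodic_configurationsD(1)[OF y])
  have "\<tau> y m = \<tau> y m'" if m: "m \<in> carrier M" "m' \<in> carrier M" "\<kappa> m = \<kappa> m'" for m m'
  proof -
    have "shift M m y = shift M m' y"
      unfolding shift_def using m by (intro restrict_ext periodic_configurationsD(2)[OF y] \<kappa>) auto
    then show ?thesis
      using cellular_automaton_value_at_one[OF M \<tau> yc] m by simp
  qed
  moreover have "\<tau> y \<in> configurations M A"
    using \<tau> yc by (auto simp: cellular_automaton_def)
  ultimately show ?thesis unfolding periodic_configurations_def by blast
qed

lemma periodic_configuration_extending:
  assumes "monoid M" and x: "x \<in> configurations M A"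
    and S: "S \<subseteq> carrier M" "inj_on \<kappa> S"
  obtains y where "y \<in> periodic_configurations M A \<kappa>" "\<And>s. s \<in> S \<Longrightarrow> y s = x s"
proof
  interpret monoid M by fact
  \<comment> \<open>Fibres of \<open>\<kappa>\<close> that miss \<open>S\<close> get an arbitrary letter; the value of \<open>x\<close> at the identity is one.\<close>
  let ?y = "\<lambda>m\<in>carrier M. x (if \<kappa> m \<in> \<kappa> ` S then inv_into S \<kappa> (\<kappa> m) else \<one>\<^bsub>M\<^esub>)"
  have "inv_into S \<kappa> (\<kappa> m) \<in> carrier M" if "\<kappa> m \<in> \<kappa> ` S" for m
    using inv_into_into[OF that] S(1) by blast
  then have "(if \<kappa> m \<in> \<kappa> ` S then inv_into S \<kappa> (\<kappa> m) else \<one>\<^bsub>M\<^esub>) \<in> carrier M" for m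
    by simp
  moreover have "x n \<in> A" if "n \<in> carrier M" for n
    using x that unfolding configurations_def by (rule PiE_mem)
  ultimately have "?y \<in> configurations M A"
    unfolding configurations_def restrict_PiE_iff by blast
  moreover have "?y m = ?y m'"
    if "m \<in> carrier M" "m' \<in> carrier M" "\<kappa> m = \<kappa> m'" for m m'
    by (simp only: restrict_apply' that)
  ultimately show "?y \<in> periodic_configurations M A \<kappa>"
    unfolding periodic_configurations_def by blast
  show "?y s = x s" if "s \<in> S" for s
    using that S by auto
qed

theorem residually_finite_CA:
  fixes M :: "('m, 'z) monoid_scheme" (structure) and A :: "'a set"
  assumes rf: "residually_finite_monoid M" and A: "finite A"
  shows "residually_finite_monoid (CA M A)"
proof -
  interpret residually_finite_monoid M by (fact rf)
  have M: "monoid M" ..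
  interpret CA: monoid "CA M A" by (rule monoid_CA[OF M])
  show ?thesis
  proof
    fix \<sigma> \<tau> assume in_CA: "\<sigma> \<in> carrier (CA M A)" "\<tau> \<in> carrier (CA M A)" and "\<sigma> \<noteq> \<tau>"
    then have \<sigma>: "cellular_automaton M A \<sigma>" and \<tau>: "cellular_automaton M A \<tau>"
      by (simp_all add: CA_def)
    then have ext: "\<sigma> \<in> configurations M A \<rightarrow>\<^sub>E configurations M A"
        "\<tau> \<in> configurations M A \<rightarrow>\<^sub>E configurations M A"
      by (simp_all add: cellular_automaton_def)
    obtain x0 where x0: "x0 \<in> configurations M A" "\<sigma> x0 \<noteq> \<tau> x0"
      using PiE_ext[OF ext] \<open>\<sigma> \<noteq> \<tau>\<close> by blast
    moreover have "\<sigma> x0 \<in> carrier M \<rightarrow>\<^sub>E A" "\<tau> x0 \<in> carrier M \<rightarrow>\<^sub>E A"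
      using ext x0(1) by (auto simp: configurations_def)
    ultimately obtain m where m: "m \<in> carrier M" "\<sigma> x0 m \<noteq> \<tau> x0 m"
      by (meson PiE_ext)
    define x where "x = shift M m x0"
    have x: "x \<in> configurations M A"
      unfolding x_def by (rule shift_configurations[OF M m(1) x0(1)])
    have ne: "\<sigma> x \<one> \<noteq> \<tau> x \<one>"
      using m x0(1) \<sigma> \<tau> by (simp add: x_def cellular_automaton_value_at_one[OF M])
    obtain S where S: "finite S" "S \<subseteq> carrier M"
      "\<And>y. y \<in> configurations M A \<Longrightarrow> (\<And>s. s \<in> S \<Longrightarrow> y s = x s) \<Longrightarrow> \<sigma> y \<one> = \<sigma> x \<one>"
      using cellular_automaton_local[OF \<sigma> x one_closed] by blast
    obtain S' where S': "finite S'" "S' \<subseteq> carrier M"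
      "\<And>y. y \<in> configurations M A \<Longrightarrow> (\<And>s. s \<in> S' \<Longrightarrow> y s = x s) \<Longrightarrow> \<tau> y \<one> = \<tau> x \<one>"
      using cellular_automaton_local[OF \<tau> x one_closed] by blast
    have SS': "finite (S \<union> S')" "S \<union> S' \<subseteq> carrier M"
      using S S' by auto
    obtain \<kappa> :: "'m \<Rightarrow> 'm \<times> 'm \<Rightarrow> nat" where
      \<kappa>: "finite (\<kappa> ` carrier M)" "inj_on \<kappa> (S \<union> S')"
        "\<And>n m m'. n \<in> carrier M \<Longrightarrow> m \<in> carrier M \<Longrightarrow> m' \<in> carrier M \<Longrightarrow> \<kappa> m = \<kappa> m' \<Longrightarrow>
          \<kappa> (n \<otimes> m) = \<kappa> (n \<otimes> m')"
      using that by (rule finite_index_separation[OF rf SS'])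
    define Y where "Y = periodic_configurations M A \<kappa>"
    have Y: "Y \<subseteq> configurations M A"
      by (auto simp: Y_def periodic_configurations_def)
    have inv: "\<upsilon> y \<in> Y" if "cellular_automaton M A \<upsilon>" "y \<in> Y" for \<upsilon> y
      unfolding Y_def
      by (rule cellular_automaton_periodic[OF M that(1) _ that(2)[unfolded Y_def]]) (rule \<kappa>(3))
    obtain y where y: "y \<in> Y" "\<And>s. s \<in> S \<union> S' \<Longrightarrow> y s = x s"
      unfolding Y_def
      using periodic_configuration_extending[OF M x SS'(2) \<kappa>(2)] by blast
    have "\<sigma> y \<one> \<noteq> \<tau> y \<one>"
      using S(3)[of y] S'(3)[of y] y Y ne by auto
    then have "restrict \<sigma> Y \<noteq> restrict \<tau> Y"
      using y(1) by (metis restrict_apply')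
    moreover have "(\<lambda>\<upsilon>. restrict \<upsilon> Y) \<in> monoid_hom (CA M A) (transformation_monoid Y)"
      using inv Y
      by (auto simp: monoid_hom_def hom_def CA_def transformation_monoid_def compose_def
          fun_eq_iff restrict_def subset_iff)
    ultimately show "\<exists>(F :: nat monoid) \<rho>. monoid F \<and> finite (carrier F) \<and>
        \<rho> \<in> monoid_hom (CA M A) F \<and> \<rho> \<sigma> \<noteq> \<rho> \<tau>"
      using finite_monoid_separation_nat[OF monoid_transformation_monoid
          finite_transformation_monoid _ in_CA]
        finite_periodic_configurations[OF A \<kappa>(1)]
      unfolding Y_def by blast
  qed
qed

section \<open>Endomorphisms of finitely generated semigroups\<close>

lemma hom_eq_on_semigroup_generate:
  assumes "h \<in> hom G F" "k \<in> hom G F" "carrier G = semigroup_generate G S"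
    and "\<And>s. s \<in> S \<Longrightarrow> h s = k s" and "x \<in> carrier G"
  shows "h x = k x"
  using assms(5) unfolding assms(3)
proof induction
  case (incl x)
  then show ?case by (rule assms(4))
next
  case (mult x y)
  then show ?case
    using assms(1-3) by (simp add: hom_mult)
qed

lemma finite_extensional_hom:
  assumes "finitely_generated_semigroup G" "finite (carrier F)"
  shows "finite (hom G F \<inter> extensional (carrier G))"
proof -
  obtain S where S: "finite S" "S \<subseteq> carrier G" "carrier G = semigroup_generate G S"
    using assms(1) by (auto simp: finitely_generated_semigroup_def)
  have "inj_on (\<lambda>h. restrict h S) (hom G F \<inter> extensional (carrier G))"
  proof (rule inj_onI)
    fix h k assume h: "h \<in> hom G F \<inter> extensional (carrier G)"
      and k: "k \<in> hom G F \<inter> extensional (carrier G)" and eq: "restrict h S = restrict k S"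
    have "h s = k s" if "s \<in> S" for s
      by (metis eq restrict_apply' that)
    then have "h x = k x" if "x \<in> carrier G" for x
      using hom_eq_on_semigroup_generate[OF IntD1[OF h] IntD1[OF k] S(3) _ that] by blast
    then show "h = k"
      by (rule extensionalityI[OF IntD2[OF h] IntD2[OF k]])
  qed
  moreover have "(\<lambda>h. restrict h S) ` (hom G F \<inter> extensional (carrier G)) \<subseteq> S \<rightarrow>\<^sub>E carrier F"
    using S(2) by (auto simp: hom_def)
  moreover have "finite (S \<rightarrow>\<^sub>E carrier F)"
    using S(1) assms(2) by (simp add: finite_PiE)
  ultimately show ?thesis
    by (meson finite_subset finite_imageD)
qed

text \<open>
  Precomposition reverses the order of composition, whence the opposite of a transformation monoid.
\<close>

theorem residually_finite_End:
  assumes closed: "\<And>x y. x \<in> carrier G \<Longrightarrow> y \<in> carrier G \<Longrightarrow> x \<otimes>\<^bsub>G\<^esub> y \<in> carrier G"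
    and fg: "finitely_generated_semigroup G"
    and sep: "\<And>x y. x \<in> carrier G \<Longrightarrow> y \<in> carrier G \<Longrightarrow> x \<noteq> y \<Longrightarrow>
      \<exists>(F :: nat monoid) \<phi>. finite (carrier F) \<and> \<phi> \<in> hom G F \<and> \<phi> x \<noteq> \<phi> y"
  shows "residually_finite_monoid (End G)"
proof -
  interpret End: monoid "End G" by (rule monoid_End[OF closed])
  show ?thesis
  proof
    fix f g assume fg_End: "f \<in> carrier (End G)" "g \<in> carrier (End G)" and "f \<noteq> g"
    then have fg_PiE: "f \<in> carrier G \<rightarrow>\<^sub>E carrier G" "g \<in> carrier G \<rightarrow>\<^sub>E carrier G"
      by (auto simp: End_def hom_def PiE_def)
    then obtain t where t: "t \<in> carrier G" "f t \<noteq> g t"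
      using \<open>f \<noteq> g\<close> by (meson PiE_ext)
    moreover have "f t \<in> carrier G" "g t \<in> carrier G"
      using fg_PiE t(1) by auto
    ultimately obtain F :: "nat monoid" and \<phi> where
      F: "finite (carrier F)" and \<phi>: "\<phi> \<in> hom G F" "\<phi> (f t) \<noteq> \<phi> (g t)"
      using sep by meson
    define H where "H = hom G F \<inter> extensional (carrier G)"
    define \<psi> where "\<psi> = restrict \<phi> (carrier G)"
    have \<psi>: "\<psi> \<in> H"
      using \<phi>(1) closed by (auto simp: \<psi>_def H_def hom_def)
    define \<rho> where "\<rho> f = (\<lambda>h\<in>H. compose (carrier G) h f)" for f
    let ?Q = "opposite_monoid (transformation_monoid H)"
    have act: "compose (carrier G) h f \<in> H" if "f \<in> carrier (End G)" "h \<in> H" for f h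
      using that closed by (simp add: H_def End_def hom_def compose_def Pi_iff)
    have "monoid ?Q" "finite (carrier ?Q)"
      using monoid_opposite_monoid[OF monoid_transformation_monoid]
        finite_transformation_monoid[OF finite_extensional_hom[OF fg F]]
      by (simp_all add: opposite_monoid_def H_def)
    moreover have "\<rho> \<in> monoid_hom (End G) ?Q"
    proof -
      have "\<rho> f \<in> H \<rightarrow>\<^sub>E H" if "f \<in> carrier (End G)" for f
        using act[OF that] by (auto simp: \<rho>_def)
      moreover have "\<rho> (compose (carrier G) f g) = compose H (\<rho> g) (\<rho> f)"
        if f: "f \<in> carrier (End G)" and g: "g \<in> carrier (End G)" for f g
      proof -
        have "g \<in> carrier G \<rightarrow> carrier G"
          using g by (simp add: End_def hom_def)
        then have "compose (carrier G) h (compose (carrier G) f g) =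
            compose (carrier G) (compose (carrier G) h f) g" for h
          by (rule compose_assoc)
        then show ?thesis
          using act[OF f] by (auto simp: \<rho>_def compose_def[of H] intro!: restrict_ext)
      qed
      moreover have "\<rho> (\<lambda>x\<in>carrier G. x) = (\<lambda>h\<in>H. h)"
        by (auto simp: \<rho>_def H_def hom_def intro!: restrict_ext compose_Id)
      ultimately show ?thesis
        by (simp add: monoid_hom_def hom_def opposite_monoid_def transformation_monoid_def
            End_def Pi_iff)
    qed
    moreover have "\<rho> f \<noteq> \<rho> g"
    proof
      assume "\<rho> f = \<rho> g"
      then have "\<rho> f \<psi> t = \<rho> g \<psi> t" by simp
      then show False
        using \<phi>(2) \<psi> t(1) \<open>f t \<in> carrier G\<close> \<open>g t \<in> carrier G\<close>
        by (simp add: \<rho>_def compose_eq) (simp add: \<psi>_def)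
    qed
    ultimately show "\<exists>(F :: nat monoid) \<rho>. monoid F \<and> finite (carrier F) \<and>
        \<rho> \<in> monoid_hom (End G) F \<and> \<rho> f \<noteq> \<rho> g"
      using finite_monoid_separation_nat[OF _ _ _ fg_End] by blast
  qed
qed

theorem corollary1p4:
  fixes M :: "('m, 'z) monoid_scheme" and A :: "'a set"
    and T :: "(('m \<Rightarrow> 'a) \<Rightarrow> ('m \<Rightarrow> 'a)) set"
  assumes "residually_finite_monoid M"
    and "finite A"
    and "subsemigroup T (CA M A)"
    and "finitely_generated_semigroup ((CA M A)\<lparr>carrier := T\<rparr>)"
  shows "residually_finite_monoid (End ((CA M A)\<lparr>carrier := T\<rparr>))"
proof (rule residually_finite_End[OF _ assms(4)])
  interpret residually_finite_monoid "CA M A"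
    by (rule residually_finite_CA[OF assms(1,2)])
  let ?G = "(CA M A)\<lparr>carrier := T\<rparr>"
  have T: "T \<subseteq> carrier (CA M A)"
    using assms(3) by (simp add: subsemigroup_def)
  show "\<sigma> \<otimes>\<^bsub>?G\<^esub> \<tau> \<in> carrier ?G" if "\<sigma> \<in> carrier ?G" "\<tau> \<in> carrier ?G" for \<sigma> \<tau>
    using that assms(3) by (simp add: subsemigroup_def)
  show "\<exists>(F :: nat monoid) \<phi>. finite (carrier F) \<and> \<phi> \<in> hom ?G F \<and> \<phi> \<sigma> \<noteq> \<phi> \<tau>"
    if st: "\<sigma> \<in> carrier ?G" "\<tau> \<in> carrier ?G" "\<sigma> \<noteq> \<tau>" for \<sigma> \<tau>
  proof -
    obtain F :: "nat monoid" and \<phi> where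
      F: "finite (carrier F)" "\<phi> \<in> monoid_hom (CA M A) F" "\<phi> \<sigma> \<noteq> \<phi> \<tau>"
      using separated[of \<sigma> \<tau>] st T by auto
    moreover have "\<phi> \<in> hom ?G F"
      using F(2) T by (auto simp: monoid_hom_def hom_def)
    ultimately show ?thesis by blast
  qed
qed

end
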